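(* Let $\langle \mathcal{B}_0,\mathcal{B}_{\to}\rangle$ be a dynamic Bayesian network over a finite non-empty set $\mathcal{X}$ of random variables with time increment $\Delta t>0$, let $\eta\in\mathbb{R}$ be a threshold, and let $\mathscr{G}_{\mathcal{X}}=(\mathcal{X}_{\to}^{(\cdot)},E_\eta(\cdot))$ be the associated dynamic Bayesian graph. Then $\mathscr{G}_{\mathcal{X}}$ is a dynamic graph over $\mathcal{X}$.
   Context: **Dynamic graph.** Let $X$ be a finite non-empty set. A dynamic graph (DG) over $X$ is a pair of maps $(V_X(\cdot),E_X(\cdot))$ assigning to each $t\in\mathbb{R}$ a set $V_X(t)\subseteq X$ and a set $E_X(t)$ of unordered pairs $\{x,x'\}$ of elements of $V_X(t)$ ($x=x'$ allowed), such that, with $\mathrm{crit}$ denoting the set of $t\in\mathbb{R}$ at which $V_X(\cdot)$ or $E_X(\cdot)$ fails to be locally constant: (i) (self-loops) if $x\in V_X(t)$ then $\{x,x\}\in E_X(t)$; (ii) (tameness) $\mathrm{crit}$ is locally finite (every bounded interval contains finitely many of its points); (iii) (lifespan) for every $x\in X$, the set $I_x=\{t\in\mathbb{R}: x\in V_X(t)\}$ is a non-empty closed interval; (iv) (comparability) for every $t\in\mathbb{R}$ and all sufficiently small $\varepsilon>0$, $V_X(t-\varepsilon)\subseteq V_X(t)\supseteq V_X(t+\varepsilon)$ and $E_X(t-\varepsilon)\subseteq E_X(t)\supseteq E_X(t+\varepsilon)$. **Dynamic Bayesian network (DBN).** There is a finite non-empty set $\mathcal{X}$ of random variables, each with a finite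 state space, and a copy $\mathcal{X}^{(k)}=\{X^{(k)}:X\in\mathcal{X}\}$ for each time slice $k=0,1,2,\dots$, representing the state of the system at time $k\Delta t$. The intra-slice directed edges form a fixed directed acyclic graph $G$ on $\mathcal{X}$, the same for every slice; there may also be inter-slice edges from slice $k-1$ to slice $k$. Each $X^{(k)}$ has a conditional probability table (CPT) giving its distribution conditional on each joint configuration of its parents; CPTs may vary with $k$. The initial network $\mathcal{B}_0$ gives the CPTs for $k=0$ and the 2-time-slice network $\mathcal{B}_{\to}$ gives those for $k\ge 1$. **Edge strength.** For probability mass functions $p,p'$ on the same finite set $S$, $d_V(p,p')=\frac12\sum_{x\in S}|p(x)-p'(x)|$. For a stochastic matrix $P$ with rows $p_1,\dots,p_n$, the upper diameter is $d^+(P)=\max_{i\ne j}d_V(p_i,p_j)$ (equal to $0$ if $n=1$). For a directed edge $Y\to X$ of $G$ and slice $k$, the edge strength is $\delta^{(k)}_{YX}=\max_{\mathbf{x}}d^+(P^{(k)}_{X|\mathbf{x}})$, where $\mathbf{x}$ ranges over joint configurations of the parents of $X^{(k)}$ other than $Y^{(k)}$, and $P^{(k)}_{X|\mathbf{x}}$ is the sub-table of the CPT of $X^{(k)}$ consisting of the rows (indexed by the states of $Y^{(k)}$) in which the other parents have configuration $\mathbf{x}$. **Dynamic Bayesian graph (DBG).** Given $\eta\in\mathbb{R}$, for each $k\ge0$ let $E^{[k]}$ be the set of all self-loops $\{X,X\}$, $X\in\mathcal{X}$, together with all undirected pairs $\{Y,X\}$ such that $Y\to X$ is an edge of $G$ and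 $\delta^{(k)}_{YX}>\eta$. The variable $X^{(k)}$ is identified with the node $X$ for all $k$. The DBG $\mathscr{G}_{\mathcal{X}}=(\mathcal{X}_{\to}^{(\cdot)},E_\eta(\cdot))$ has vertex set $\mathcal{X}_{\to}^{(t)}=\mathcal{X}$ for all $t\in\mathbb{R}_+=[0,\infty)$, and edge sets $E_\eta(t)=E^{[k]}$ for $k\Delta t<t<(k+1)\Delta t$, $k\ge 0$; $E_\eta(k\Delta t)=E^{[k-1]}\cup E^{[k]}$ for $k\ge1$ (maximum convention at transition times); $E_\eta(0)=E^{[0]}$. For $t<0$ the vertex and edge sets are empty. *)

theory Defs
  imports "HOL-Probability.Probability_Mass_Function"
begin

section \<open>Dynamic graphs\<close>

definition locally_constant_at :: "(real \<Rightarrow> 'b) \<Rightarrow> real \<Rightarrow> bool" where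
  "locally_constant_at f t \<longleftrightarrow> (\<forall>\<^sub>F s in nhds t. f s = f t)"

definition crit :: "(real \<Rightarrow> 'x set) \<Rightarrow> (real \<Rightarrow> 'x set set) \<Rightarrow> real set" where
  "crit V E = {t. \<not> locally_constant_at V t \<or> \<not> locally_constant_at E t}"

text \<open>An unordered pair of elements is the set \<open>{x, x'}\<close>; a self-loop is the singleton
  \<open>{x, x}\<close>. A closed interval may be unbounded.\<close>

locale dynamic_graph =
  fixes X :: "'x set" and V :: "real \<Rightarrow> 'x set" and E :: "real \<Rightarrow> 'x set set"
  assumes finite_X: "finite X"
    and nonempty_X: "X \<noteq> {}"
    and vertices: "\<And>t. V t \<subseteq> X"
    and edges: "\<And>t. E t \<subseteq> {{x, x'} | x x'. x \<in> V t \<and> x' \<in> V t}"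
    and self_loops: "\<And>t x. x \<in> V t \<Longrightarrow> {x, x} \<in> E t"
    and tameness: "\<And>a b. finite (crit V E \<inter> {a..b})"
    and lifespan: "\<And>x. x \<in> X \<Longrightarrow>
          {t. x \<in> V t} \<noteq> {} \<and> is_interval {t. x \<in> V t} \<and> closed {t. x \<in> V t}"
    and comparability: "\<And>t. \<forall>\<^sub>F \<epsilon> in at_right 0.
          V (t - \<epsilon>) \<subseteq> V t \<and> V (t + \<epsilon>) \<subseteq> V t \<and> E (t - \<epsilon>) \<subseteq> E t \<and> E (t + \<epsilon>) \<subseteq> E t"


section \<open>Dynamic Bayesian networks\<close>

text \<open>The node \<open>(k, X)\<close> is the copy of the variable \<open>X\<close> in time slice \<open>k\<close>.\<close>

type_synonym 'x node = "nat \<times> 'x"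

text \<open>\<open>(Y, X) \<in> intra B\<close> is the edge from \<open>Y\<close> to \<open>X\<close> inside every slice;
  \<open>(Y, X) \<in> inter B k\<close>, for \<open>k \<ge> 1\<close>, is the edge from \<open>(k - 1, Y)\<close> to \<open>(k, X)\<close>.
  The initial network contributes the table \<open>init_cpt B X\<close> of \<open>(0, X)\<close>, and the
  2-time-slice network the tables \<open>trans_cpt B k X\<close> of \<open>(k, X)\<close> for \<open>k \<ge> 1\<close>
  (the values of \<open>inter\<close> and \<open>trans_cpt\<close> at \<open>k = 0\<close> are never used).
  A table maps each joint configuration of the parents to a distribution.\<close>

record ('x, 's) dbn =
  vars :: "'x set"
  states :: "'x \<Rightarrow> 's set"
  intra :: "('x \<times> 'x) set"
  inter :: "nat \<Rightarrow> ('x \<times> 'x) set"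
  init_cpt :: "'x \<Rightarrow> ('x node \<Rightarrow> 's) \<Rightarrow> 's pmf"
  trans_cpt :: "nat \<Rightarrow> 'x \<Rightarrow> ('x node \<Rightarrow> 's) \<Rightarrow> 's pmf"

definition cpt :: "('x, 's) dbn \<Rightarrow> nat \<Rightarrow> 'x \<Rightarrow> ('x node \<Rightarrow> 's) \<Rightarrow> 's pmf" where
  "cpt B k X = (if k = 0 then init_cpt B X else trans_cpt B k X)"

definition parents :: "('x, 's) dbn \<Rightarrow> nat \<Rightarrow> 'x \<Rightarrow> 'x node set" where
  "parents B k X = {(k, Y) | Y. (Y, X) \<in> intra B}
     \<union> {(j, Y) | j Y. k = Suc j \<and> (Y, X) \<in> inter B k}"

definition configs :: "('x, 's) dbn \<Rightarrow> 'x node set \<Rightarrow> ('x node \<Rightarrow> 's) set" where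
  "configs B N = (\<Pi>\<^sub>E (j, Y) \<in> N. states B Y)"

locale dynamic_bayesian_network =
  fixes B :: "('x, 's) dbn"
  assumes finite_vars: "finite (vars B)"
    and nonempty_vars: "vars B \<noteq> {}"
    and finite_states: "\<And>X. X \<in> vars B \<Longrightarrow> finite (states B X)"
    and nonempty_states: "\<And>X. X \<in> vars B \<Longrightarrow> states B X \<noteq> {}"
    and intra_edges: "intra B \<subseteq> vars B \<times> vars B"
    and acyclic_intra: "acyclic (intra B)"
    and inter_edges: "\<And>k. k \<ge> 1 \<Longrightarrow> inter B k \<subseteq> vars B \<times> vars B"
    and cpt_support: "\<And>k X c. X \<in> vars B \<Longrightarrow> c \<in> configs B (parents B k X) \<Longrightarrow>
          set_pmf (cpt B k X c) \<subseteq> states B X"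


section \<open>Edge strength\<close>

definition d_V :: "'s set \<Rightarrow> 's pmf \<Rightarrow> 's pmf \<Rightarrow> real" where
  "d_V S p p' = (1 / 2) * (\<Sum>x\<in>S. \<bar>pmf p x - pmf p' x\<bar>)"

text \<open>The stochastic matrix has rows \<open>p i\<close> for \<open>i \<in> I\<close> and columns indexed by \<open>S\<close>.\<close>

definition upper_diameter :: "'s set \<Rightarrow> 'i set \<Rightarrow> ('i \<Rightarrow> 's pmf) \<Rightarrow> real" where
  "upper_diameter S I p =
     (if card I \<le> 1 then 0
      else Max {d_V S (p i) (p j) | i j. i \<in> I \<and> j \<in> I \<and> i \<noteq> j})"

definition edge_strength :: "('x, 's) dbn \<Rightarrow> nat \<Rightarrow> 'x \<Rightarrow> 'x \<Rightarrow> real" where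
  "edge_strength B k Y X =
     Max ((\<lambda>c. upper_diameter (states B X) (states B Y) (\<lambda>y. cpt B k X (c((k, Y) := y))))
          ` configs B (parents B k X - {(k, Y)}))"


section \<open>Dynamic Bayesian graphs\<close>

definition slice_edges :: "('x, 's) dbn \<Rightarrow> real \<Rightarrow> nat \<Rightarrow> 'x set set" where
  "slice_edges B \<eta> k = {{X, X} | X. X \<in> vars B}
     \<union> {{Y, X} | Y X. (Y, X) \<in> intra B \<and> edge_strength B k Y X > \<eta>}"

definition dbg_vertices :: "('x, 's) dbn \<Rightarrow> real \<Rightarrow> 'x set" where
  "dbg_vertices B t = (if t < 0 then {} else vars B)"

definition dbg_edges :: "('x, 's) dbn \<Rightarrow> real \<Rightarrow> real \<Rightarrow> real \<Rightarrow> 'x set set" where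
  "dbg_edges B \<Delta>t \<eta> t =
     (let k = nat \<lfloor>t / \<Delta>t\<rfloor> in
      if t < 0 then {}
      else if t = 0 then slice_edges B \<eta> 0
      else if t = real k * \<Delta>t then slice_edges B \<eta> (k - 1) \<union> slice_edges B \<eta> k
      else slice_edges B \<eta> k)"

text \<open>The following equations determine \<open>dbg_edges\<close> when \<open>\<Delta>t > 0\<close>.\<close>

lemma dbg_edges_neg: "t < 0 \<Longrightarrow> dbg_edges B \<Delta>t \<eta> t = {}"
  by (simp add: dbg_edges_def)

lemma dbg_edges_zero: "dbg_edges B \<Delta>t \<eta> 0 = slice_edges B \<eta> 0"
  by (simp add: dbg_edges_def)

lemma dbg_edges_transition:
  assumes "\<Delta>t > 0" "k \<ge> 1"
  shows "dbg_edges B \<Delta>t \<eta> (real k * \<Delta>t) = slice_edges B \<eta> (k - 1) \<union> slice_edges B \<eta> k"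
proof -
  have "\<not> real k * \<Delta>t < 0" using assms by (simp add: not_less del: mult_less_0_iff)
  then show ?thesis using assms by (simp add: dbg_edges_def)
qed

lemma dbg_edges_open:
  assumes "\<Delta>t > 0" "real k * \<Delta>t < t" "t < (real k + 1) * \<Delta>t"
  shows "dbg_edges B \<Delta>t \<eta> t = slice_edges B \<eta> k"
proof -
  have "0 \<le> real k * \<Delta>t" using assms(1) by simp
  then have "0 < t" using assms(2) by linarith
  have "\<lfloor>t / \<Delta>t\<rfloor> = int k"
    using assms by (simp add: floor_eq_iff field_simps)
  then show ?thesis
    using \<open>0 < t\<close> assms(2) by (simp add: dbg_edges_def)
qed

end

theory Submission imports Defs begin

text \<open>Slice \<open>k\<close> owns the closed interval \<open>[k \<Delta>t, (k + 1) \<Delta>t]\<close>. The maximum convention at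
  transition times says precisely that the edge set at time \<open>t\<close> is the union of the slice edge sets
  over all slices whose interval contains \<open>t\<close>, and the vertex set is nonempty exactly when there
  is such a slice (\<open>dbg_edges_eq_Union\<close>, \<open>dbg_vertices_eq\<close>). The whole graph at time \<open>t\<close> thus
  depends monotonically on the set of active slices alone, and the analytic conditions become
  statements about a locally finite family of closed intervals. A time close to \<open>t\<close> can only lie
  in intervals that already contain \<open>t\<close> (\<open>active_slices_upper_semicontinuous\<close>), which is
  comparability. If moreover \<open>t\<close> is none of the transition times \<open>k \<Delta>t\<close>, then it is interior to
  each interval containing it, so the set of active slices is constant near \<open>t\<close>
  (\<open>active_slices_locally_constant\<close>); hence all critical times have the form \<open>k \<Delta>t\<close>, which is
  tameness. The intervals together cover \<open>[0, \<infinity>)\<close>, the common lifespan of all variables.\<close>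

section \<open>Slices active at a given time\<close>

definition active_slices :: "real \<Rightarrow> real \<Rightarrow> nat set" where
  "active_slices \<Delta>t t = {k. real k * \<Delta>t \<le> t \<and> t \<le> (real k + 1) * \<Delta>t}"

lemma active_slices_neg:
  assumes "\<Delta>t > 0" "t < 0"
  shows "active_slices \<Delta>t t = {}"
proof -
  have "\<not> real k * \<Delta>t \<le> t" for k
    using assms mult_nonneg_nonneg[of "real k" \<Delta>t] by linarith
  then show ?thesis
    by (auto simp: active_slices_def)
qed

lemma time_in_slice:
  fixes \<Delta>t t :: real
  assumes "\<Delta>t > 0" "t \<ge> 0"
  obtains k :: nat where "real k * \<Delta>t \<le> t" "t < (real k + 1) * \<Delta>t"
proof
  have "0 \<le> t / \<Delta>t"
    using assms by simp
  then have "real (nat \<lfloor>t / \<Delta>t\<rfloor>) \<le> t / \<Delta>t" "t / \<Delta>t < real (nat \<lfloor>t / \<Delta>t\<rfloor>) + 1"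
    by linarith+
  with assms(1) show "real (nat \<lfloor>t / \<Delta>t\<rfloor>) * \<Delta>t \<le> t" "t < (real (nat \<lfloor>t / \<Delta>t\<rfloor>) + 1) * \<Delta>t"
    by (simp_all only: pos_le_divide_eq pos_divide_less_eq)
qed

lemma active_slices_empty_iff:
  assumes "\<Delta>t > 0"
  shows "active_slices \<Delta>t t = {} \<longleftrightarrow> t < 0"
proof
  assume empty: "active_slices \<Delta>t t = {}"
  show "t < 0"
  proof (rule ccontr)
    assume "\<not> t < 0"
    then have "t \<ge> 0"
      by simp
    with assms obtain k :: nat where "real k * \<Delta>t \<le> t" "t < (real k + 1) * \<Delta>t"
      by (rule time_in_slice)
    then have "k \<in> active_slices \<Delta>t t"
      by (simp add: active_slices_def)
    with empty show False
      by simp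
  qed
qed (simp add: active_slices_neg assms)

lemma active_slices_open:
  assumes "\<Delta>t > 0" "real k * \<Delta>t < t" "t < (real k + 1) * \<Delta>t"
  shows "active_slices \<Delta>t t = {k}"
proof -
  have unique: "j = k" if "real j * \<Delta>t \<le> t" "t \<le> (real j + 1) * \<Delta>t" for j :: nat
  proof -
    have "real j * \<Delta>t < (real k + 1) * \<Delta>t" "real k * \<Delta>t < (real j + 1) * \<Delta>t"
      using that assms by linarith+
    with assms(1) show ?thesis
      by simp
  qed
  show ?thesis
    using assms(2,3) by (auto simp: active_slices_def intro: unique)
qed

text \<open>At time \<open>0\<close> slice \<open>0\<close> has no predecessor and is the only active one; the truncated
  \<open>0 - 1 = 0\<close> makes the formula cover this case.\<close>

lemma active_slices_transition:
  assumes "\<Delta>t > 0"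
  shows "active_slices \<Delta>t (real k * \<Delta>t) = {k - 1, k}"
proof -
  have "active_slices \<Delta>t (real k * \<Delta>t) = {j. real j \<le> real k \<and> real k \<le> real j + 1}"
    using assms by (simp add: active_slices_def)
  also have "\<dots> = {k - 1, k}"
  proof (rule set_eqI)
    fix j
    have "(real j \<le> real k \<and> real k \<le> real j + 1) \<longleftrightarrow> j = k - 1 \<or> j = k"
      by linarith
    then show "j \<in> {j. real j \<le> real k \<and> real k \<le> real j + 1} \<longleftrightarrow> j \<in> {k - 1, k}"
      by (simp only: mem_Collect_eq insert_iff empty_iff simp_thms)
  qed
  finally show ?thesis .
qed

section \<open>The graph as a function of the active slices\<close>

text \<open>This trades the case distinction on \<open>t\<close> for a formula monotone in the set of active slices.
  Between transition times the union has one term; at \<open>k \<Delta>t\<close> with \<open>k \<ge> 1\<close> it has the two terms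
  of the maximum convention.\<close>

lemma dbg_edges_eq_Union:
  assumes "\<Delta>t > 0"
  shows "dbg_edges B \<Delta>t \<eta> t = (\<Union>k\<in>active_slices \<Delta>t t. slice_edges B \<eta> k)"
proof (cases "t < 0")
  case True
  with assms show ?thesis
    by (simp add: dbg_edges_neg active_slices_neg)
next
  case False
  then have "t \<ge> 0"
    by simp
  with assms obtain k :: nat where k: "real k * \<Delta>t \<le> t" "t < (real k + 1) * \<Delta>t"
    by (rule time_in_slice)
  show ?thesis
  proof (cases "t = real k * \<Delta>t")
    case True
    then show ?thesis
    proof (cases "k = 0")
      case True
      then have "t = 0" "active_slices \<Delta>t 0 = {0}"
        using \<open>t = real k * \<Delta>t\<close> active_slices_transition[OF assms, of 0] by simp_all
      then show ?thesis
        by (simp add: dbg_edges_zero)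
    next
      case False
      then have "k \<ge> 1"
        by simp
      then show ?thesis
        by (simp only: \<open>t = real k * \<Delta>t\<close> dbg_edges_transition[OF assms]
            active_slices_transition[OF assms]) simp
    qed
  next
    case False
    with k(1) have "real k * \<Delta>t < t"
      by linarith
    then show ?thesis
      by (simp only: dbg_edges_open[OF assms _ k(2)] active_slices_open[OF assms _ k(2)]) simp
  qed
qed

lemma dbg_vertices_eq:
  assumes "\<Delta>t > 0"
  shows "dbg_vertices B t = (\<Union>k\<in>active_slices \<Delta>t t. vars B)"
  using active_slices_empty_iff[OF assms, of t] by (simp add: dbg_vertices_def)

section \<open>Variation of the active slices with time\<close>

text \<open>Each slice that is inactive at \<open>t\<close> stays inactive near \<open>t\<close>, because its interval is closed.
  The neighbourhood can be chosen uniformly in the slice: beyond some index \<open>N\<close> all intervals lie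
  to the right of a neighbourhood of \<open>t\<close>, and only finitely many indices remain.\<close>

lemma active_slices_upper_semicontinuous:
  assumes "\<Delta>t > 0"
  shows "\<forall>\<^sub>F s in nhds t. active_slices \<Delta>t s \<subseteq> active_slices \<Delta>t t"
proof -
  obtain N :: nat where N: "t < real N * \<Delta>t"
    using assms reals_Archimedean3 by blast
  have right: "\<forall>\<^sub>F s in nhds t. s < real N * \<Delta>t"
    using N by (intro eventually_nhds_in_open[of "{..<real N * \<Delta>t}", simplified])
  have "\<forall>\<^sub>F s in nhds t. k \<notin> active_slices \<Delta>t s" if "k \<notin> active_slices \<Delta>t t" for k
  proof -
    have "open (- {real k * \<Delta>t..(real k + 1) * \<Delta>t})"
      by (intro open_Compl closed_atLeastAtMost)
    moreover have "t \<in> - {real k * \<Delta>t..(real k + 1) * \<Delta>t}"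
      using that by (simp add: active_slices_def)
    ultimately have "\<forall>\<^sub>F s in nhds t. s \<in> - {real k * \<Delta>t..(real k + 1) * \<Delta>t}"
      by (rule eventually_nhds_in_open)
    then show ?thesis
      by eventually_elim (simp add: active_slices_def)
  qed
  then have "\<forall>\<^sub>F s in nhds t. \<forall>k\<in>{..<N} - active_slices \<Delta>t t. k \<notin> active_slices \<Delta>t s"
    by (intro eventually_ball_finite) auto
  with right show ?thesis
  proof eventually_elim
    case (elim s)
    have "k < N" if "k \<in> active_slices \<Delta>t s" for k
    proof -
      have "real k * \<Delta>t < real N * \<Delta>t"
        using that elim(1) by (simp add: active_slices_def)
      with assms show ?thesis
        by simp
    qed
    with elim(2) show ?case
      by blast
  qed
qed

text \<open>Between transition times exactly one slice is active. At negative times none is, which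
  upper semicontinuity alone propagates to a neighbourhood.\<close>

lemma active_slices_locally_constant:
  assumes "\<Delta>t > 0" "\<And>k. t \<noteq> real k * \<Delta>t"
  shows "\<forall>\<^sub>F s in nhds t. active_slices \<Delta>t s = active_slices \<Delta>t t"
proof (cases "t < 0")
  case True
  then show ?thesis
    using active_slices_upper_semicontinuous[OF assms(1), of t] assms(1)
    by (simp add: active_slices_neg)
next
  case False
  then have "t \<ge> 0"
    by simp
  with assms(1) obtain k :: nat where "real k * \<Delta>t \<le> t" "t < (real k + 1) * \<Delta>t"
    by (rule time_in_slice)
  with assms(2)[of k] have t: "t \<in> {real k * \<Delta>t<..<(real k + 1) * \<Delta>t}"
    by simp
  have "\<forall>\<^sub>F s in nhds t. s \<in> {real k * \<Delta>t<..<(real k + 1) * \<Delta>t}"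
    by (rule eventually_nhds_in_open[OF open_greaterThanLessThan t])
  then show ?thesis
  proof eventually_elim
    case (elim s)
    with t have "active_slices \<Delta>t s = {k}" "active_slices \<Delta>t t = {k}"
      by (simp_all add: active_slices_open[OF assms(1), of k])
    then show ?case
      by simp
  qed
qed

section \<open>The dynamic graph axioms\<close>

lemma crit_dbg_subset:
  assumes "\<Delta>t > 0"
  shows "crit (dbg_vertices B) (dbg_edges B \<Delta>t \<eta>) \<subseteq> range (\<lambda>k. real k * \<Delta>t)"
proof
  fix t
  assume crit: "t \<in> crit (dbg_vertices B) (dbg_edges B \<Delta>t \<eta>)"
  show "t \<in> range (\<lambda>k. real k * \<Delta>t)"
  proof (rule ccontr)
    assume "t \<notin> range (\<lambda>k. real k * \<Delta>t)"
    then have "\<forall>\<^sub>F s in nhds t. active_slices \<Delta>t s = active_slices \<Delta>t t"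
      using assms by (intro active_slices_locally_constant) auto
    then have "locally_constant_at (dbg_vertices B) t"
      "locally_constant_at (dbg_edges B \<Delta>t \<eta>) t"
      unfolding locally_constant_at_def dbg_vertices_eq[OF assms] dbg_edges_eq_Union[OF assms]
      by (eventually_elim, simp)+
    with crit show False
      by (simp add: crit_def)
  qed
qed

lemma finite_multiples_in_interval:
  fixes d :: real
  assumes "d > 0"
  shows "finite (range (\<lambda>k. real k * d) \<inter> {a..b})"
proof -
  obtain N :: nat where N: "b < real N * d"
    using assms reals_Archimedean3 by blast
  have "k < N" if "real k * d \<le> b" for k
  proof -
    have "real k * d < real N * d"
      using that N by linarith
    with assms show ?thesis
      by simp
  qed
  then have "range (\<lambda>k. real k * d) \<inter> {a..b} \<subseteq> (\<lambda>k. real k * d) ` {..<N}"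
    by auto
  then show ?thesis
    by (rule finite_subset) simp
qed

lemma dbg_locally_maximal:
  assumes "\<Delta>t > 0"
  shows "\<forall>\<^sub>F s in nhds t. dbg_vertices B s \<subseteq> dbg_vertices B t \<and>
           dbg_edges B \<Delta>t \<eta> s \<subseteq> dbg_edges B \<Delta>t \<eta> t"
  using active_slices_upper_semicontinuous[OF assms]
proof eventually_elim
  case (elim s)
  then show ?case
    unfolding dbg_vertices_eq[OF assms] dbg_edges_eq_Union[OF assms]
    by (intro conjI UN_mono order_refl)
qed

lemma slice_edges_subset:
  assumes "intra B \<subseteq> vars B \<times> vars B"
  shows "slice_edges B \<eta> k \<subseteq> {{x, x'} | x x'. x \<in> vars B \<and> x' \<in> vars B}"
proof
  fix e
  assume "e \<in> slice_edges B \<eta> k"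
  then consider X where "e = {X, X}" "X \<in> vars B" | Y X where "e = {Y, X}" "(Y, X) \<in> intra B"
    by (simp only: slice_edges_def Un_iff mem_Collect_eq) (elim disjE exE conjE)
  then show "e \<in> {{x, x'} | x x'. x \<in> vars B \<and> x' \<in> vars B}"
  proof cases
    case 1
    then show ?thesis
      by (intro CollectI exI conjI)
  next
    case 2
    then show ?thesis
      using assms by (intro CollectI exI conjI) auto
  qed
qed

theorem proposition4p4:
  fixes B :: "('x, 's) dbn" and \<Delta>t \<eta> :: real
  assumes "dynamic_bayesian_network B"
    and "\<Delta>t > 0"
  shows "dynamic_graph (vars B) (dbg_vertices B) (dbg_edges B \<Delta>t \<eta>)"
proof
  show "finite (vars B)" "vars B \<noteq> {}"
    using assms(1) by (simp_all add: dynamic_bayesian_network_def)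
next
  fix t
  show "dbg_vertices B t \<subseteq> vars B"
    by (simp add: dbg_vertices_def)
  show "dbg_edges B \<Delta>t \<eta> t \<subseteq> {{x, x'} | x x'. x \<in> dbg_vertices B t \<and> x' \<in> dbg_vertices B t}"
  proof (cases "t < 0")
    case True
    then show ?thesis
      by (simp add: dbg_edges_neg)
  next
    case False
    then have "dbg_vertices B t = vars B"
      by (simp add: dbg_vertices_def)
    then show ?thesis
      unfolding dbg_edges_eq_Union[OF assms(2)]
      by (simp only:) (intro UN_least slice_edges_subset
          dynamic_bayesian_network.intra_edges[OF assms(1)])
  qed
next
  fix t x
  assume "x \<in> dbg_vertices B t"
  then show "{x, x} \<in> dbg_edges B \<Delta>t \<eta> t"
    unfolding dbg_vertices_eq[OF assms(2)] dbg_edges_eq_Union[OF assms(2)] slice_edges_def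
    by blast
next
  fix a b
  show "finite (crit (dbg_vertices B) (dbg_edges B \<Delta>t \<eta>) \<inter> {a..b})"
    by (rule finite_subset[OF Int_mono[OF crit_dbg_subset[OF assms(2)] order_refl]
          finite_multiples_in_interval[OF assms(2)]])
next
  fix x
  assume "x \<in> vars B"
  then have "{t. x \<in> dbg_vertices B t} = {0..}"
    by (auto simp: dbg_vertices_def)
  then show "{t. x \<in> dbg_vertices B t} \<noteq> {} \<and> is_interval {t. x \<in> dbg_vertices B t}
      \<and> closed {t. x \<in> dbg_vertices B t}"
    by (simp add: is_interval_ci)
next
  fix t :: real
  have minus: "((\<lambda>\<epsilon>. t - \<epsilon>) \<longlongrightarrow> t) (at_right 0)"
    using tendsto_diff[OF tendsto_const[of t] tendsto_ident_at[of "0::real" "{0<..}"]] by simp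
  have plus: "((\<lambda>\<epsilon>. t + \<epsilon>) \<longlongrightarrow> t) (at_right 0)"
    using tendsto_add[OF tendsto_const[of t] tendsto_ident_at[of "0::real" "{0<..}"]] by simp
  let ?below = "\<lambda>s. dbg_vertices B s \<subseteq> dbg_vertices B t \<and> dbg_edges B \<Delta>t \<eta> s \<subseteq> dbg_edges B \<Delta>t \<eta> t"
  have "\<forall>\<^sub>F s in nhds t. ?below s"
    by (rule dbg_locally_maximal[OF assms(2)])
  then have near: "\<forall>\<^sub>F \<epsilon> in F. ?below (f \<epsilon>)" if "(f \<longlongrightarrow> t) F" for f and F :: "real filter"
    using that by (rule eventually_compose_filterlim[where P = ?below])
  from near[OF minus] near[OF plus] show "\<forall>\<^sub>F \<epsilon> in at_right 0.
      dbg_vertices B (t - \<epsilon>) \<subseteq> dbg_vertices B t \<and> dbg_vertices B (t + \<epsilon>) \<subseteq> dbg_vertices B t \<and>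
      dbg_edges B \<Delta>t \<eta> (t - \<epsilon>) \<subseteq> dbg_edges B \<Delta>t \<eta> t \<and>
      dbg_edges B \<Delta>t \<eta> (t + \<epsilon>) \<subseteq> dbg_edges B \<Delta>t \<eta> t"
    by eventually_elim (elim conjE, intro conjI)
qed

end
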